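(* Let $\mu,\nu$ be probability measures supported on countable subsets $X$ and $Y$ of $[0,\infty)$ respectively, with $\int x\,\mu(dx)=\int y\,\nu(dy)=1$ and $\mu\preccurlyeq\nu$ in the convex order. Let $Q\in\mathcal M(\mu,\nu)$ be extremal in $\mathcal M(\mu,\nu)$. Then the support of $Q$ does not contain any cycle of 2-meshes.
   Context: $\mu\preccurlyeq\nu$ in the convex order means $\int c\,d\mu\le\int c\,d\nu$ for all convex $c:[0,\infty)\to\mathbb R$. $\mathcal M(\mu,\nu)$ is the set of probability measures $Q$ on $[0,\infty)^2$ with marginals $\mu,\nu$ satisfying the martingale property: if $Q(dx,dy)=q(x,dy)\mu(dx)$ then $\int y\,q(x,dy)=x$ for $\mu$-a.e. $x$. $Q\in\mathcal M(\mu,\nu)$ is extremal if $Q=\alpha Q_1+(1-\alpha)Q_2$ with $\alpha\in(0,1)$, $Q_1,Q_2\in\mathcal M(\mu,\nu)$ implies $Q=Q_1=Q_2$. The support of $Q$ is $\{(x,y)\in X\times Y:Q(\{(x,y)\})>0\}$. A 2-mesh is a set $\{(x,y),(x,y')\}$ with $x\in X$ and $y\neq y'$ in $Y$; it is identified with the pair consisting of the point $x$ and the two-element set $\{y,y'\}$. A cycle of 2-meshes is a (classical) cycle in the product of $X$ with the set of two-element subsets of $Y$. Explicitly, a set $S\subset X\times Y$ contains a cycle of 2-meshes if there are $n\ge2$, distinct points $x_1,\dots,x_n\in X$ and distinct two-element subsets $P_1,\dots,P_n$ of $Y$ such that $\{x_i\}\times P_i\subset S$ and $\{x_{i+1}\}\times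 P_i\subset S$ for all $1\le i\le n$, with $x_{n+1}=x_1$. *)

theory Defs
  imports "HOL-Probability.Probability"
begin

definition halfline :: "real measure" where
  "halfline = restrict_space borel {0..}"

definition prob_on_halfline :: "real measure \<Rightarrow> bool" where
  "prob_on_halfline \<mu> \<longleftrightarrow> prob_space \<mu> \<and> sets \<mu> = sets halfline"

(* Integral with values in the extended reals, positive part minus negative part (ennreal truncates
   negative reals to 0). The Bochner integral would return 0 for a non-integrable function. If \<mu> lives
   on the half-line and has finite mean, the negative part of a convex function has finite
   integral (affine minorant), so that no difference of infinities arises. *)
definition ext_integral :: "'a measure \<Rightarrow> ('a \<Rightarrow> real) \<Rightarrow> ereal" where
  "ext_integral \<mu> c =
     enn2ereal (\<integral>\<^sup>+x. ennreal (c x) \<partial>\<mu>) - enn2ereal (\<integral>\<^sup>+x. ennreal (- c x) \<partial>\<mu>)"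

definition convex_order :: "real measure \<Rightarrow> real measure \<Rightarrow> bool" where
  "convex_order \<mu> \<nu> \<longleftrightarrow> (\<forall>c. convex_on {0..} c \<longrightarrow> ext_integral \<mu> c \<le> ext_integral \<nu> c)"

(* Q(dx,dy) = q(x,dy) \<mu>(dx) for a Markov kernel q on the half-line. *)
definition disintegrates ::
    "(real \<times> real) measure \<Rightarrow> real measure \<Rightarrow> (real \<Rightarrow> real measure) \<Rightarrow> bool" where
  "disintegrates Q \<mu> q \<longleftrightarrow>
     q \<in> halfline \<rightarrow>\<^sub>M prob_algebra halfline \<and>
     (\<forall>A\<in>sets Q. emeasure Q A = (\<integral>\<^sup>+x. emeasure (q x) (Pair x -` A) \<partial>\<mu>))"

(* Disintegrations of a measure on the quadrant exist and are unique \<mu>-almost everywhere, so that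
   asking for one martingale kernel is the same as asking it of every kernel. Integrability
   has to be stated because the Bochner integral of a non-integrable function is 0, which would
   be accepted at x = 0. *)
definition martingale_couplings :: "real measure \<Rightarrow> real measure \<Rightarrow> (real \<times> real) measure set" where
  "martingale_couplings \<mu> \<nu> =
     {Q. prob_space Q \<and> sets Q = sets (halfline \<Otimes>\<^sub>M halfline) \<and>
         distr Q halfline fst = \<mu> \<and> distr Q halfline snd = \<nu> \<and>
         (\<exists>q. disintegrates Q \<mu> q \<and>
              (AE x in \<mu>. integrable (q x) (\<lambda>y. y) \<and> (\<integral>y. y \<partial>q x) = x))}"

definition extremal_coupling ::
    "real measure \<Rightarrow> real measure \<Rightarrow> (real \<times> real) measure \<Rightarrow> bool" where
  "extremal_coupling \<mu> \<nu> Q \<longleftrightarrow>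
     Q \<in> martingale_couplings \<mu> \<nu> \<and>
     (\<forall>\<alpha>. \<forall>Q1\<in>martingale_couplings \<mu> \<nu>. \<forall>Q2\<in>martingale_couplings \<mu> \<nu>.
        0 < \<alpha> \<and> \<alpha> < 1 \<and>
        (\<forall>A\<in>sets Q. measure Q A = \<alpha> * measure Q1 A + (1 - \<alpha>) * measure Q2 A)
        \<longrightarrow> Q = Q1 \<and> Q = Q2)"

definition coupling_support ::
    "real set \<Rightarrow> real set \<Rightarrow> (real \<times> real) measure \<Rightarrow> (real \<times> real) set" where
  "coupling_support X Y Q = {(x, y) \<in> X \<times> Y. measure Q {(x, y)} > 0}"

(* Indices run cyclically through 0, ..., n - 1. *)
definition contains_2mesh_cycle :: "'a set \<Rightarrow> 'b set \<Rightarrow> ('a \<times> 'b) set \<Rightarrow> bool" where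
  "contains_2mesh_cycle X Y S \<longleftrightarrow>
     (\<exists>(n::nat) (x :: nat \<Rightarrow> 'a) (P :: nat \<Rightarrow> 'b set).
        n \<ge> 2 \<and> inj_on x {..<n} \<and> inj_on P {..<n} \<and>
        (\<forall>i<n. x i \<in> X \<and> P i \<subseteq> Y \<and> card (P i) = 2 \<and>
               {x i} \<times> P i \<subseteq> S \<and> {x (Suc i mod n)} \<times> P i \<subseteq> S))"

end

theory Submission
  imports Defs
begin

text \<open>
  On a two-element set there is exactly one signed measure with given mass and given barycentre.
  Let \<open>\<alpha>\<^sub>i\<close> be the one on \<open>P\<^sub>i\<close> with mass \<open>1\<close> and barycentre \<open>b\<close>, the same \<open>b\<close> for all \<open>i\<close>. Putting
  \<open>\<alpha>\<^sub>i\<close> on the row of \<open>x\<^sub>i\<close> and \<open>-\<alpha>\<^sub>i\<close> on the row of \<open>x\<^sub>i\<^sub>+\<^sub>1\<close> gives a signed measure \<open>\<theta>\<close> on the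
  cycle whose columns sum to zero and whose rows have zero mass and zero barycentre. If \<open>b\<close> avoids
  all the \<open>P\<^sub>i\<close>, then \<open>\<alpha>\<^sub>i\<close> charges every point of \<open>P\<^sub>i\<close>, so that \<open>\<theta>\<close> is nonzero because the
  \<open>P\<^sub>i\<close> are distinct. For small \<open>\<epsilon>\<close> both \<open>Q + \<epsilon> \<theta>\<close> and \<open>Q - \<epsilon> \<theta>\<close> are martingale couplings, and \<open>Q\<close>
  is their midpoint.
\<close>

section \<open>Signed measures carried by a cycle of 2-meshes\<close>

text \<open>Mass and barycentre form an invertible 2x2 linear system in the two weights. By its
  explicit solution a weight vanishes only if \<open>b\<close> is the other point, whence the exact
  description of the support.\<close>

lemma two_point_signed_measure:
  fixes P :: "real set"
  assumes "card P = 2" "b \<notin> P"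
  obtains a :: "real \<Rightarrow> real"
  where "\<And>v. a v \<noteq> 0 \<longleftrightarrow> v \<in> P" "(\<Sum>v\<in>P. a v) = 1" "(\<Sum>v\<in>P. v * a v) = b"
proof -
  obtain y z where P: "P = {y, z}" "y \<noteq> z"
    using assms(1) by (auto simp: card_2_iff)
  define a where "a v = (if v = y then (b - z) / (y - z) else if v = z then (y - b) / (y - z) else 0)" for v
  show thesis
  proof
    show "a v \<noteq> 0 \<longleftrightarrow> v \<in> P" for v
      using P assms(2) by (auto simp: a_def)
    show "(\<Sum>v\<in>P. a v) = 1"
      using P by (simp add: a_def add_divide_distrib [symmetric])
    show "(\<Sum>v\<in>P. v * a v) = b"
      using P by (simp add: a_def add_divide_distrib [symmetric] divide_eq_eq) (simp add: algebra_simps)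
  qed
qed

lemma bij_betw_Suc_mod:
  assumes "0 < n"
  shows "bij_betw (\<lambda>i. Suc i mod n) {..<n} {..<n}"
proof -
  have "inj_on (\<lambda>i. Suc i mod n) {..<n}"
    by (rule inj_onI) (auto simp: mod_Suc split: if_splits)
  moreover have "(\<lambda>i. Suc i mod n) ` {..<n} \<subseteq> {..<n}"
    using assms by auto
  ultimately show ?thesis
    by (simp add: bij_betw_def endo_inj_surj)
qed

text \<open>This extracts from the cycle all that is used later: a nonzero direction
  \<open>\<theta>\<close> in a finite box whose cancellations are finite sums.\<close>

lemma cycle_signed_measure:
  fixes S :: "(real \<times> real) set"
  assumes "contains_2mesh_cycle X Y S"
  obtains U V \<theta> where
    "finite U" "finite V" "{p. \<theta> p \<noteq> 0} \<subseteq> S \<inter> U \<times> V"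
    "\<forall>v. (\<Sum>u\<in>U. \<theta> (u, v)) = 0"
    "\<forall>u. (\<Sum>v\<in>V. \<theta> (u, v)) = 0" "\<forall>u. (\<Sum>v\<in>V. v * \<theta> (u, v)) = 0"
    "\<exists>p. \<theta> p \<noteq> (0::real)"
proof -
  obtain n :: nat and x P where n: "n \<ge> 2" and inj: "inj_on x {..<n}" "inj_on P {..<n}"
    and card: "\<And>i. i < n \<Longrightarrow> card (P i) = 2"
    and S: "\<And>i. i < n \<Longrightarrow> {x i} \<times> P i \<subseteq> S" "\<And>i. i < n \<Longrightarrow> {x (Suc i mod n)} \<times> P i \<subseteq> S"
    using assms unfolding contains_2mesh_cycle_def by metis
  define U where "U = x ` {..<n}"
  define V where "V = (\<Union>i<n. P i)"
  have finP: "finite (P i)" if "i < n" for i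
    using card[OF that] by (simp add: card_ge_0_finite)
  have fin: "finite U" "finite V"
    using finP by (auto simp: U_def V_def)
  \<comment> \<open>One \<open>b\<close> must serve all meshes: the barycentres on a row cancel only
    because they are equal.\<close>
  obtain b where b: "b \<notin> V"
    using ex_new_if_finite[OF infinite_UNIV_char_0 fin(2)] by blast
  have "\<exists>a. (\<forall>v. a v \<noteq> (0::real) \<longleftrightarrow> v \<in> P i) \<and> (\<Sum>v\<in>P i. a v) = 1 \<and> (\<Sum>v\<in>P i. v * a v) = b"
    if "i < n" for i
    using two_point_signed_measure[OF card[OF that], of b] b that unfolding V_def by blast
  then obtain a where a: "\<And>i v. i < n \<Longrightarrow> a i v \<noteq> (0::real) \<longleftrightarrow> v \<in> P i"
    and "\<And>i. i < n \<Longrightarrow> (\<Sum>v\<in>P i. a i v) = 1" "\<And>i. i < n \<Longrightarrow> (\<Sum>v\<in>P i. v * a i v) = b"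
    by metis
  moreover have "(\<Sum>v\<in>V. a i v) = (\<Sum>v\<in>P i. a i v)" "(\<Sum>v\<in>V. v * a i v) = (\<Sum>v\<in>P i. v * a i v)"
    if "i < n" for i
    using a[OF that] that fin by (auto intro!: sum.mono_neutral_right simp: V_def)
  ultimately have mass: "\<And>i. i < n \<Longrightarrow> (\<Sum>v\<in>V. a i v) = 1"
    and mean: "\<And>i. i < n \<Longrightarrow> (\<Sum>v\<in>V. v * a i v) = b"
    by simp_all
  \<comment> \<open>\<open>s i\<close> is the sign of mesh \<open>i\<close> on each row, and
    \<open>\<theta>\<close> is a sum of products of a function of the row and a function of the
    column, so that sums along rows and columns factor.\<close>
  define s where "s i u = of_bool (u = x i) - (of_bool (u = x (Suc i mod n)) :: real)" for i u
  define \<theta> where "\<theta> p = (\<Sum>i<n. s i (fst p) * a i (snd p))" for p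
  \<comment> \<open>The cyclic shift permutes the indices, so every row is entered as often as it is
    left. As all \<open>a i\<close> share mass and barycentre, this is what cancels the rows of
    \<open>\<theta>\<close>.\<close>
  have s_cols: "(\<Sum>i<n. s i u) = 0" for u
    using sum.reindex_bij_betw[OF bij_betw_Suc_mod, of n "\<lambda>i. of_bool (u = x i) :: real"] n
    by (simp add: s_def sum_subtractf)
  have s_rows: "(\<Sum>u\<in>U. s i u) = 0" if "i < n" for i
  proof -
    have "x i \<in> U" "x (Suc i mod n) \<in> U"
      using that by (auto simp: U_def)
    then show ?thesis
      using fin by (simp add: s_def sum_subtractf of_bool_def)
  qed
  show thesis
  proof
    show "finite U" "finite V" by fact+
    have "(u, v) \<in> S \<and> u \<in> U \<and> v \<in> V" if nz: "\<theta> (u, v) \<noteq> 0" for u v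
    proof -
      obtain i where i: "i < n" "s i u \<noteq> 0" "a i v \<noteq> 0"
        using nz unfolding \<theta>_def by (force elim: sum.not_neutral_contains_not_neutral)
      then have "v \<in> P i" "u = x i \<or> u = x (Suc i mod n)"
        using a by (auto simp: s_def split: if_splits)
      then show ?thesis
        using S[of i] i(1) by (auto simp: U_def V_def)
    qed
    then show "{p. \<theta> p \<noteq> 0} \<subseteq> S \<inter> U \<times> V"
      by auto
    show "\<forall>v. (\<Sum>u\<in>U. \<theta> (u, v)) = 0"
    proof
      fix v
      have "(\<Sum>u\<in>U. \<theta> (u, v)) = (\<Sum>i<n. (\<Sum>u\<in>U. s i u) * a i v)"
        unfolding \<theta>_def by (subst sum.swap) (simp add: sum_distrib_right)
      then show "(\<Sum>u\<in>U. \<theta> (u, v)) = 0" by (simp add: s_rows)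
    qed
    show "\<forall>u. (\<Sum>v\<in>V. \<theta> (u, v)) = 0"
    proof
      fix u
      have "(\<Sum>v\<in>V. \<theta> (u, v)) = (\<Sum>i<n. s i u * (\<Sum>v\<in>V. a i v))"
        unfolding \<theta>_def by (subst sum.swap) (simp add: sum_distrib_left)
      then show "(\<Sum>v\<in>V. \<theta> (u, v)) = 0" by (simp add: mass s_cols)
    qed
    show "\<forall>u. (\<Sum>v\<in>V. v * \<theta> (u, v)) = 0"
    proof
      fix u
      have "(\<Sum>v\<in>V. v * \<theta> (u, v)) = (\<Sum>i<n. s i u * (\<Sum>v\<in>V. v * a i v))"
        unfolding \<theta>_def sum_distrib_left by (subst sum.swap) (simp add: mult_ac)
      then show "(\<Sum>v\<in>V. v * \<theta> (u, v)) = 0" by (simp add: mean s_cols flip: sum_distrib_right)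
    qed
    show "\<exists>p. \<theta> p \<noteq> 0"
    proof (rule ccontr)
      assume "\<nexists>p. \<theta> p \<noteq> 0"
      then have zero: "\<theta> (x 1, v) = 0" for v by blast
      \<comment> \<open>Row \<open>x 1\<close> meets only mesh 1, with sign plus, and mesh 0, with
        sign minus; this includes \<open>n = 2\<close>, where the successor of 1 wraps around to
        0.\<close>
      have s1: "s i (x 1) = of_bool (i = 1) - of_bool (i = 0)" if "i < n" for i
      proof -
        have "x 1 = x i \<longleftrightarrow> i = 1"
          using inj_on_eq_iff[OF inj(1), of 1 i] that n by auto
        moreover have "x 1 = x (Suc i mod n) \<longleftrightarrow> i = 0"
          using inj_on_eq_iff[OF inj(1), of 1 "Suc i mod n"] that n by (auto simp: mod_Suc split: if_splits)
        ultimately show ?thesis by (simp add: s_def)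
      qed
      have "\<theta> (x 1, v) = a 1 v - a 0 v" for v
      proof -
        have "\<theta> (x 1, v) = (\<Sum>i<n. (if i = 1 then a i v else 0) - (if i = 0 then a i v else 0))"
          unfolding \<theta>_def by (rule sum.cong) (auto simp: s1 simp del: One_nat_def)
        then show ?thesis using n by (simp add: sum_subtractf)
      qed
      \<comment> \<open>If row \<open>x 1\<close> of \<open>\<theta>\<close> vanished, the two
        weight functions would agree, and so would their supports \<open>P 1\<close> and
        \<open>P 0\<close>.\<close>
      then have "a 1 v = a 0 v" for v
        using zero[of v] by simp
      then have "P 1 = P 0"
        using a[of 0] a[of 1] n by auto
      then show False
        using inj_onD[OF inj(2), of 1 0] n by auto
    qed
  qed
qed

section \<open>Densities that differ from 1 at finitely many points\<close>

text \<open>\<open>g\<close> is a finite combination of indicators of measurable singletons, so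
  \<open>g * h\<close> is integrable and its integral is a finite sum. The measure is general
  because both the coupling and its kernels get perturbed.\<close>

lemma density_finite_perturbation:
  fixes g h :: "'a \<Rightarrow> real"
  assumes "finite_measure M" "finite F"
    and F: "\<And>p. g p \<noteq> 0 \<Longrightarrow> p \<in> F \<and> {p} \<in> sets M" and nonneg: "\<And>p. 0 \<le> 1 + g p"
    and h: "integrable M h"
  shows "integrable (density M (\<lambda>p. ennreal (1 + g p))) h"
    and "(\<integral>p. h p \<partial>density M (\<lambda>p. ennreal (1 + g p))) =
      (\<integral>p. h p \<partial>M) + (\<Sum>p\<in>F. g p * measure M {p} * h p)"
proof -
  interpret finite_measure M by fact
  have g_sum: "g p = (\<Sum>a\<in>F. g a * indicator {a} p)" for p
    using F[of p] \<open>finite F\<close> by (cases "p \<in> F") (auto simp: indicator_def if_distrib sum.delta cong: if_cong)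
  \<comment> \<open>Where \<open>g a = 0\<close> the singleton need not be measurable, but then the
    term is the zero function. The same split recurs below.\<close>
  have meas_term: "(\<lambda>p. g a * indicator {a} p) \<in> borel_measurable M" for a
    using F[of a] by (cases "g a = 0") auto
  have "(\<lambda>p. \<Sum>a\<in>F. g a * indicator {a} p) \<in> borel_measurable M"
    by (intro borel_measurable_sum meas_term)
  then have g_meas [measurable]: "g \<in> borel_measurable M"
    by (simp flip: g_sum)
  note [measurable] = borel_measurable_integrable[OF h]
  have gh: "(\<lambda>p. g p * h p) = (\<lambda>p. \<Sum>a\<in>F. g a * h a * indicator {a} p)"
    by (rule ext, subst g_sum) (auto simp: sum_distrib_right indicator_def intro!: sum.cong)
  have int_term: "integrable M (\<lambda>p. g a * h a * indicator {a} p)"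
    for a
    using F[of a] by (cases "g a = 0") (auto simp: less_top[symmetric])
  have val_term: "(\<integral>p. g a * h a * indicator {a} p \<partial>M) = g a * measure M {a} * h a" for a
    using F[of a] by (cases "g a = 0") simp_all
  have int_gh: "integrable M (\<lambda>p. g p * h p)"
    by (subst gh) (intro Bochner_Integration.integrable_sum int_term)
  have val_gh: "(\<integral>p. g p * h p \<partial>M) = (\<Sum>p\<in>F. g p * measure M {p} * h p)"
    by (subst gh, subst Bochner_Integration.integral_sum) (rule int_term, rule sum.cong, rule refl, rule val_term)
  show "integrable (density M (\<lambda>p. ennreal (1 + g p))) h"
    using h int_gh nonneg by (subst integrable_density) (auto simp: distrib_right)
  show "(\<integral>p. h p \<partial>density M (\<lambda>p. ennreal (1 + g p))) =
      (\<integral>p. h p \<partial>M) + (\<Sum>p\<in>F. g p * measure M {p} * h p)"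
    using h int_gh nonneg by (subst integral_density) (auto simp: distrib_right val_gh)
qed

text \<open>These are the cases of a constant integrand, for finiteness, and of an indicator, for
  the measure of a set.\<close>

lemma measure_density_finite_perturbation:
  fixes g :: "'a \<Rightarrow> real"
  assumes M: "finite_measure M" and F: "finite F" "\<And>p. g p \<noteq> 0 \<Longrightarrow> p \<in> F \<and> {p} \<in> sets M"
    and nonneg: "\<And>p. 0 \<le> 1 + g p"
  shows "finite_measure (density M (\<lambda>p. ennreal (1 + g p)))"
    and "A \<in> sets M \<Longrightarrow> measure (density M (\<lambda>p. ennreal (1 + g p))) A =
      measure M A + (\<Sum>p\<in>F. g p * measure M {p} * indicator A p)"
proof -
  interpret finite_measure M by fact
  let ?N = "density M (\<lambda>p. ennreal (1 + g p))"
  have "integrable ?N (\<lambda>_. 1::real)"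
    by (rule density_finite_perturbation(1)[OF M F nonneg integrable_const])
  then show fin: "finite_measure ?N"
    by (intro finite_measureI) (auto simp: less_top)
  then interpret N: finite_measure ?N .
  assume A: "A \<in> sets M"
  then have "(\<integral>p. indicator A p \<partial>?N) =
      (\<integral>p. indicator A p \<partial>M) + (\<Sum>p\<in>F. g p * measure M {p} * (indicator A p :: real))"
    using M F nonneg by (intro density_finite_perturbation) (auto simp: less_top[symmetric])
  then show "measure ?N A = measure M A + (\<Sum>p\<in>F. g p * measure M {p} * indicator A p)"
    using A by simp
qed

section \<open>Integration along a disintegration\<close>

text \<open>\<open>disintegrates\<close> speaks of sets only. To pass to functions,
  \<open>q x\<close> is pushed onto the fibre over \<open>x\<close>, giving \<open>K x\<close>; then
  \<open>Q\<close> is the monadic bind of \<open>\<mu>\<close> and \<open>K\<close>, for which the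
  integral formula is known.\<close>

lemma disintegrates_nn_integral:
  assumes Q: "disintegrates Q \<mu> q" "sets Q = sets (halfline \<Otimes>\<^sub>M halfline)"
    and \<mu>: "sets \<mu> = sets halfline"
    and h: "h \<in> borel_measurable (halfline \<Otimes>\<^sub>M halfline)"
  shows "(\<integral>\<^sup>+p. h p \<partial>Q) = (\<integral>\<^sup>+x. (\<integral>\<^sup>+y. h (x, y) \<partial>q x) \<partial>\<mu>)"
proof -
  let ?H = "halfline \<Otimes>\<^sub>M halfline"
  define K where "K x = distr (q x) ?H (Pair x)" for x
  have q: "q \<in> \<mu> \<rightarrow>\<^sub>M subprob_algebra halfline"
    using Q(1) measurable_prob_algebraD measurable_cong_sets[OF \<mu> refl]
    unfolding disintegrates_def by blast
  have K: "K \<in> \<mu> \<rightarrow>\<^sub>M subprob_algebra ?H"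
    unfolding K_def
    by (rule measurable_distr2[OF _ q])
       (simp add: measurable_cong_sets[OF sets_pair_measure_cong[OF \<mu> refl] refl])
  have sets_q: "sets (q x) = sets halfline" if "x \<in> space \<mu>" for x
    using measurable_space[OF q that] by (simp add: space_subprob_algebra)
  have Pair_meas: "Pair x \<in> q x \<rightarrow>\<^sub>M ?H" if "x \<in> space \<mu>" for x
    using that sets_eq_imp_space_eq[OF \<mu>] measurable_cong_sets[OF sets_q[OF that] refl, of ?H]
    by simp
  have ne: "space \<mu> \<noteq> {}"
    using sets_eq_imp_space_eq[OF \<mu>] by (auto simp: halfline_def)
  have "Q = \<mu> \<bind> K"
  proof (rule measure_eqI)
    show "sets Q = sets (\<mu> \<bind> K)"
      using Q(2) K ne by (simp add: sets_bind[OF sets_kernel[OF K]])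
    fix A assume A: "A \<in> sets Q"
    then have "emeasure (\<mu> \<bind> K) A = (\<integral>\<^sup>+x. emeasure (K x) A \<partial>\<mu>)"
      using Q(2) by (intro emeasure_bind[OF ne K]) simp
    also have "\<dots> = (\<integral>\<^sup>+x. emeasure (q x) (Pair x -` A) \<partial>\<mu>)"
    proof (rule nn_integral_cong)
      fix x assume x: "x \<in> space \<mu>"
      have "emeasure (K x) A = emeasure (q x) (Pair x -` A \<inter> space (q x))"
        unfolding K_def using A Q(2) by (intro emeasure_distr Pair_meas x) simp
      also have "Pair x -` A \<inter> space (q x) = Pair x -` A"
        using sets.sets_into_space[OF A] sets_eq_imp_space_eq[OF Q(2)]
          sets_eq_imp_space_eq[OF sets_q[OF x]]
        by (auto simp: space_pair_measure)
      finally show "emeasure (K x) A = emeasure (q x) (Pair x -` A)" .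
    qed
    also have "\<dots> = emeasure Q A"
      using Q(1) A by (simp add: disintegrates_def)
    finally show "emeasure Q A = emeasure (\<mu> \<bind> K) A" ..
  qed
  then have "(\<integral>\<^sup>+p. h p \<partial>Q) = (\<integral>\<^sup>+x. (\<integral>\<^sup>+p. h p \<partial>K x) \<partial>\<mu>)"
    using nn_integral_bind[OF h K] by simp
  also have "\<dots> = (\<integral>\<^sup>+x. (\<integral>\<^sup>+y. h (x, y) \<partial>q x) \<partial>\<mu>)"
    unfolding K_def using h by (intro nn_integral_cong nn_integral_distr Pair_meas) simp_all
  finally show ?thesis .
qed

lemma singleton_in_halfline: "0 \<le> x \<Longrightarrow> {x} \<in> sets halfline"
  by (simp add: halfline_def sets_restrict_space_iff)

text \<open>Only the fibre over \<open>x\<close> meets the singleton, so the integrand is a multiple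
  of the indicator of \<open>{x}\<close>. This translates weights relative to \<open>Q\<close> into
  weights relative to \<open>q x\<close>.\<close>

lemma disintegrates_singleton:
  assumes Q: "disintegrates Q \<mu> q" "sets Q = sets (halfline \<Otimes>\<^sub>M halfline)"
    and \<mu>: "sets \<mu> = sets halfline" and "0 \<le> x" "0 \<le> y"
  shows "measure Q {(x, y)} = measure \<mu> {x} * measure (q x) {y}"
proof -
  have x: "{x} \<in> sets \<mu>" and "{(x, y)} \<in> sets Q"
    using assms pair_measureI[of "{x}" halfline "{y}" halfline]
    by (simp_all add: singleton_in_halfline)
  then have "emeasure Q {(x, y)} = (\<integral>\<^sup>+z. emeasure (q z) (Pair z -` {(x, y)}) \<partial>\<mu>)"
    using Q(1) by (simp add: disintegrates_def)
  also have "\<dots> = (\<integral>\<^sup>+z. emeasure (q x) {y} * indicator {x} z \<partial>\<mu>)"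
    by (intro nn_integral_cong) (auto simp: indicator_def vimage_def)
  also have "\<dots> = emeasure (q x) {y} * emeasure \<mu> {x}"
    using x by (rule nn_integral_cmult_indicator)
  finally show ?thesis
    by (simp add: measure_def enn2real_mult mult.commute)
qed

section \<open>Finite perturbations of martingale couplings\<close>

text \<open>Domination by the atoms of \<open>Q\<close> makes \<open>Q\<close> plus
  \<open>\<theta>\<close> a measure with density \<open>1 + g\<close> against \<open>Q\<close>. Zero
  columns preserve \<open>\<nu>\<close>, zero rows preserve \<open>\<mu>\<close> and the mass of
  each kernel, and zero row barycentres preserve the martingale property.\<close>

lemma martingale_couplings_perturbation:
  assumes Q: "Q \<in> martingale_couplings \<mu> \<nu>"
    and fin: "finite U" "finite V"
    and supp: "\<And>u v. \<theta> (u, v) \<noteq> 0 \<Longrightarrow> u \<in> U \<and> v \<in> V"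
    and bound: "\<And>p. \<bar>\<theta> p\<bar> \<le> measure Q {p}"
    and cols: "\<And>v. (\<Sum>u\<in>U. \<theta> (u, v)) = 0"
    and rows: "\<And>u. (\<Sum>v\<in>V. \<theta> (u, v)) = 0" "\<And>u. (\<Sum>v\<in>V. v * \<theta> (u, v)) = 0"
  obtains Q' where "Q' \<in> martingale_couplings \<mu> \<nu>"
    "\<forall>A\<in>sets Q. measure Q' A = measure Q A + (\<Sum>p\<in>U \<times> V. \<theta> p * indicator A p)"
proof -
  let ?H = "halfline \<Otimes>\<^sub>M halfline"
  from Q obtain q where "prob_space Q" and setsQ: "sets Q = sets ?H"
    and fst: "distr Q halfline fst = \<mu>" and snd: "distr Q halfline snd = \<nu>"
    and dis: "disintegrates Q \<mu> q"
    and mart: "AE x in \<mu>. integrable (q x) (\<lambda>y. y) \<and> (\<integral>y. y \<partial>q x) = x"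
    unfolding martingale_couplings_def by blast
  interpret Q: prob_space Q by fact
  have spaceH: "space halfline = {0..}"
    by (simp add: halfline_def)
  have spaceQ: "space Q = {0..} \<times> {0..}"
    using sets_eq_imp_space_eq[OF setsQ] by (simp add: space_pair_measure spaceH)
  have sets\<mu>: "sets \<mu> = sets halfline" and space\<mu>: "space \<mu> = {0..}"
    unfolding fst[symmetric] by (simp_all add: spaceH)
  have fst_meas [measurable]: "fst \<in> Q \<rightarrow>\<^sub>M halfline" and snd_meas [measurable]: "snd \<in> Q \<rightarrow>\<^sub>M halfline"
    by (simp_all add: measurable_cong_sets[OF setsQ refl])
  have qprob: "prob_space (q x)" and setsq: "sets (q x) = sets halfline" if "0 \<le> x" for x
    using dis that spaceH measurable_space[of q halfline "prob_algebra halfline" x]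
    by (auto simp: disintegrates_def space_prob_algebra)
  \<comment> \<open>Where \<open>Q\<close> has no atom the quotient is 0 by convention, and there
    \<open>\<theta>\<close> is 0 too by \<open>bound\<close>; hence \<open>gQ\<close> holds at every
    point.\<close>
  define g where "g p = \<theta> p / measure Q {p}" for p
  have g_nonneg: "0 \<le> 1 + g p" for p
  proof -
    have "\<bar>g p\<bar> \<le> 1"
      using bound[of p] by (auto simp: g_def divide_le_eq_1)
    then show ?thesis by linarith
  qed
  have Qpos: "{p} \<in> sets Q" "measure Q {p} \<noteq> 0" if "\<theta> p \<noteq> 0" for p
  proof -
    show "measure Q {p} \<noteq> 0"
      using bound[of p] that by auto
    \<comment> \<open>\<open>measure\<close> is 0 outside the sigma-algebra, so a nonzero value
      forces measurability.\<close>
    then show "{p} \<in> sets Q"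
      using measure_notin_sets by metis
  qed
  have gF: "p \<in> U \<times> V \<and> {p} \<in> sets Q" if "g p \<noteq> 0" for p
    using that supp[of "fst p" "snd p"] Qpos[of p] by (auto simp: g_def mem_Times_iff)
  have gQ: "g p * measure Q {p} = \<theta> p" for p
    using bound[of p] by (auto simp: g_def)
  have finUV: "finite (U \<times> V)" using fin by simp
  define Q' where "Q' = density Q (\<lambda>p. ennreal (1 + g p))"
  have setsQ': "sets Q' = sets Q" by (simp add: Q'_def)
  have measQ': "measure Q' A = measure Q A + (\<Sum>p\<in>U \<times> V. \<theta> p * indicator A p)"
    if "A \<in> sets Q" for A
    using measure_density_finite_perturbation(2)[OF Q.finite_measure_axioms finUV gF g_nonneg that]
    by (simp add: Q'_def gQ)
  interpret Q': finite_measure Q'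
    unfolding Q'_def
    by (rule measure_density_finite_perturbation(1)[OF Q.finite_measure_axioms finUV gF g_nonneg])
  \<comment> \<open>The arbitrary \<open>f\<close> makes this say that \<open>\<theta>\<close>
    annihilates functions of the second coordinate; indicators then give the marginal.
    \<open>sum_fst\<close> is the analogue for the first, and with the constant 1 it also gives the
    total mass.\<close>
  have sum_snd: "(\<Sum>p\<in>U \<times> V. \<theta> p * f (snd p)) = 0" for f :: "real \<Rightarrow> real"
  proof -
    have "(\<Sum>p\<in>U \<times> V. \<theta> p * f (snd p)) = (\<Sum>v\<in>V. (\<Sum>u\<in>U. \<theta> (u, v)) * f v)"
      unfolding sum_distrib_right
      by (subst sum.swap) (simp add: sum.cartesian_product case_prod_unfold)
    then show ?thesis by (simp add: cols)
  qed
  have sum_fst: "(\<Sum>p\<in>U \<times> V. \<theta> p * f (fst p)) = 0" for f :: "real \<Rightarrow> real"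
  proof -
    have "(\<Sum>p\<in>U \<times> V. \<theta> p * f (fst p)) = (\<Sum>u\<in>U. (\<Sum>v\<in>V. \<theta> (u, v)) * f u)"
      unfolding sum_distrib_right by (simp add: sum.cartesian_product case_prod_unfold)
    then show ?thesis by (simp add: rows)
  qed
  have indicator_nz: "\<theta> p * indicator (f -` B \<inter> space Q) p = \<theta> p * indicator B (f p)"
    for p B and f :: "real \<times> real \<Rightarrow> real"
    using Qpos(1)[of p] sets.sets_into_space[of "{p}" Q] by (cases "\<theta> p = 0") (auto simp: indicator_def)
  have marg: "emeasure Q' (f -` B \<inter> space Q) = emeasure Q (f -` B \<inter> space Q)"
    if "f \<in> Q \<rightarrow>\<^sub>M halfline" "B \<in> sets halfline"
      "\<And>c. (\<Sum>p\<in>U \<times> V. \<theta> p * c (f p)) = 0" for f :: "real \<times> real \<Rightarrow> real" and B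
    using measQ'[OF measurable_sets[OF that(1,2)]] that(3)[of "indicator B"]
    by (simp add: indicator_nz Q.emeasure_eq_measure Q'.emeasure_eq_measure)
  have distr: "distr Q' halfline f = distr Q halfline f"
    if f: "f \<in> Q \<rightarrow>\<^sub>M halfline" and 0: "\<And>c. (\<Sum>p\<in>U \<times> V. \<theta> p * c (f p)) = 0"
    for f :: "real \<times> real \<Rightarrow> real"
  proof (rule measure_eqI)
    fix B assume "B \<in> sets (distr Q' halfline f)"
    then have B: "B \<in> sets halfline" by simp
    have "f \<in> Q' \<rightarrow>\<^sub>M halfline" "space Q' = space Q"
      using f by (simp_all add: Q'_def)
    then show "emeasure (distr Q' halfline f) B = emeasure (distr Q halfline f) B"
      using f B marg[OF f B 0] by (simp add: emeasure_distr)
  qed simp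
  have prob: "prob_space Q'"
  proof
    have "measure Q' (space Q) = 1"
    proof -
      have "\<theta> p * indicator (space Q) p = \<theta> p" for p
        using indicator_nz[of p "fst" UNIV] by simp
      then have "(\<Sum>p\<in>U \<times> V. \<theta> p * indicator (space Q) p) = (\<Sum>p\<in>U \<times> V. \<theta> p)"
        by (rule sum.cong[OF refl])
      then show ?thesis
        using sum_fst[of "\<lambda>_. 1"] by (simp add: measQ' Q.prob_space)
    qed
    then show "emeasure Q' (space Q') = 1"
      by (simp add: Q'.emeasure_eq_measure) (simp add: Q'_def)
  qed
  \<comment> \<open>Each fibre gets the restriction of the density of \<open>Q'\<close>, so that the
    disintegration formula for \<open>Q\<close> carries over to \<open>Q'\<close>.\<close>
  define q' where "q' x = density (q x) (\<lambda>y. ennreal (1 + g (x, y)))" for x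
  have gF_row: "v \<in> V \<and> {v} \<in> sets (q x)" if "0 \<le> x" "g (x, v) \<noteq> 0" for x v
    using gF[OF that(2)] sets.sets_into_space[of "{(x, v)}" Q] that(1)
    by (auto simp: spaceQ setsq singleton_in_halfline)
  \<comment> \<open>If \<open>\<mu>\<close> does not charge \<open>x\<close>, both sides vanish, the right one since division by 0 gives 0.\<close>
  have gq: "g (x, v) * measure (q x) {v} = \<theta> (x, v) / measure \<mu> {x}" if "0 \<le> x" for x v
  proof (cases "\<theta> (x, v) = 0")
    case False
    then have "0 \<le> v"
      using sets.sets_into_space[OF Qpos(1)[OF False]] by (auto simp: spaceQ)
    then show ?thesis
      using Qpos(2)[OF False] disintegrates_singleton[OF dis setsQ sets\<mu> that, of v]
      by (simp add: g_def field_simps)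
  qed (simp add: g_def)
  \<comment> \<open>By \<open>gq\<close> the change of \<open>q x\<close> is row \<open>x\<close> of
    \<open>\<theta>\<close> times a constant, so its mass and barycentre remain zero.\<close>
  have row: "finite_measure (q' x)" "measure (q' x) (space (q x)) = 1"
    "integrable (q x) (\<lambda>y. y) \<Longrightarrow> integrable (q' x) (\<lambda>y. y)"
    "integrable (q x) (\<lambda>y. y) \<Longrightarrow> (\<integral>y. y \<partial>q' x) = (\<integral>y. y \<partial>q x)"
    if x: "0 \<le> x" for x
  proof -
    interpret q: prob_space "q x" by (rule qprob[OF x])
    note fm = q.finite_measure_axioms fin(2) gF_row[OF x] g_nonneg[of "(x, _)"]
    show "finite_measure (q' x)"
      unfolding q'_def by (rule measure_density_finite_perturbation(1)[OF fm])
    have "(\<Sum>v\<in>V. \<theta> (x, v) / measure \<mu> {x} * indicator (space (q x)) v) =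
        (\<Sum>v\<in>V. \<theta> (x, v) / measure \<mu> {x})"
    proof (rule sum.cong)
      fix v
      show "\<theta> (x, v) / measure \<mu> {x} * indicator (space (q x)) v = \<theta> (x, v) / measure \<mu> {x}"
        using sets.sets_into_space[OF Qpos(1)[of "(x, v)"]] sets_eq_imp_space_eq[OF setsq[OF x]]
        by (cases "\<theta> (x, v) = 0") (auto simp: spaceQ spaceH)
    qed simp
    then show "measure (q' x) (space (q x)) = 1"
      unfolding q'_def using measure_density_finite_perturbation(2)[OF fm sets.top]
      by (simp add: q.prob_space gq[OF x] rows flip: sum_divide_distrib)
    assume int: "integrable (q x) (\<lambda>y. y)"
    show "integrable (q' x) (\<lambda>y. y)"
      unfolding q'_def by (rule density_finite_perturbation(1)[OF fm int])
    have "(\<Sum>v\<in>V. \<theta> (x, v) / measure \<mu> {x} * v) = 0"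
      using rows(2)[of x] by (simp add: mult.commute flip: sum_divide_distrib)
    then show "(\<integral>y. y \<partial>q' x) = (\<integral>y. y \<partial>q x)"
      unfolding q'_def using density_finite_perturbation(2)[OF fm int]
      by (simp add: gq[OF x])
  qed
  have q'_off: "q x = q' x" if "x \<notin> U" for x
  proof -
    have "g (x, y) = 0" for y
      using gF[of "(x, y)"] that by auto
    then show ?thesis by (simp add: q'_def density_1)
  qed
  \<comment> \<open>\<open>q'\<close> differs from \<open>q\<close> only at points of the finite set
    \<open>U\<close>, so measurability is inherited; what remains is that the new values are
    probability measures.\<close>
  have q'_meas: "q' \<in> halfline \<rightarrow>\<^sub>M prob_algebra halfline"
  proof (rule measurable_discrete_difference[where f = q and X = "U \<inter> {0..}"])
    show "q \<in> halfline \<rightarrow>\<^sub>M prob_algebra halfline"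
      using dis by (simp add: disintegrates_def)
    show "countable (U \<inter> {0..})"
      using fin by (simp add: countable_finite)
    show "q' x \<in> space (prob_algebra halfline)" if "x \<in> U \<inter> {0..}" for x
    proof -
      have x: "0 \<le> x" using that by simp
      interpret finite_measure "q' x" by (rule row(1)[OF x])
      have "prob_space (q' x)"
        by standard (use row(2)[OF x] in \<open>simp add: emeasure_eq_measure\<close>, simp add: q'_def)
      then show ?thesis
        using setsq[OF x] by (simp add: space_prob_algebra q'_def)
    qed
  qed (auto simp: spaceH singleton_in_halfline q'_off)
  have g_meas: "(\<lambda>p. ennreal (1 + g p)) \<in> borel_measurable ?H"
  proof -
    \<comment> \<open>The exceptional set keeps only points with measurable singletons; at all
      others \<open>g\<close> is 0.\<close>
    have "g \<in> borel_measurable ?H"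
      by (rule measurable_discrete_difference[where f = "\<lambda>_. 0" and X = "{p \<in> U \<times> V. {p} \<in> sets Q}"])
        (use gF finUV setsQ sets.sets_into_space[of _ ?H] in \<open>auto intro: countable_finite\<close>)
    then show ?thesis by simp
  qed
  have "disintegrates Q' \<mu> q'"
    unfolding disintegrates_def
  proof (intro conjI ballI q'_meas)
    fix A assume "A \<in> sets Q'"
    then have A: "A \<in> sets ?H" by (simp add: setsQ' setsQ)
    have "emeasure Q' A = (\<integral>\<^sup>+p. ennreal (1 + g p) * indicator A p \<partial>Q)"
      unfolding Q'_def using g_meas A setsQ
      by (intro emeasure_density) (simp_all add: measurable_cong_sets[OF setsQ refl])
    also have "\<dots> = (\<integral>\<^sup>+x. (\<integral>\<^sup>+y. ennreal (1 + g (x, y)) * indicator A (x, y) \<partial>q x) \<partial>\<mu>)"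
      using g_meas A by (intro disintegrates_nn_integral[OF dis setsQ sets\<mu>]) simp
    also have "\<dots> = (\<integral>\<^sup>+x. emeasure (q' x) (Pair x -` A) \<partial>\<mu>)"
    proof (rule nn_integral_cong)
      fix x assume "x \<in> space \<mu>"
      then have x: "0 \<le> x" by (simp add: space\<mu>)
      have "(\<lambda>y. ennreal (1 + g (x, y))) \<in> borel_measurable (q x)"
        using measurable_compose[OF measurable_Pair1'[of x halfline] g_meas] x
        by (simp add: measurable_cong_sets[OF setsq[OF x] refl] spaceH)
      moreover have "Pair x -` A \<in> sets (q x)"
        using sets_Pair1[OF A] setsq[OF x] by simp
      moreover have "indicator (Pair x -` A) y = (indicator A (x, y) :: ennreal)" for y
        by (simp add: indicator_def)
      ultimately show "(\<integral>\<^sup>+y. ennreal (1 + g (x, y)) * indicator A (x, y) \<partial>q x) =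
          emeasure (q' x) (Pair x -` A)"
        unfolding q'_def by (simp add: emeasure_density)
    qed
    finally show "emeasure Q' A = (\<integral>\<^sup>+x. emeasure (q' x) (Pair x -` A) \<partial>\<mu>)" .
  qed
  moreover have "AE x in \<mu>. integrable (q' x) (\<lambda>y. y) \<and> (\<integral>y. y \<partial>q' x) = x"
    using mart AE_space by eventually_elim (simp add: row space\<mu>)
  ultimately have "Q' \<in> martingale_couplings \<mu> \<nu>"
    using prob distr[OF fst_meas sum_fst] distr[OF snd_meas sum_snd] fst snd setsQ setsQ'
    unfolding martingale_couplings_def by auto
  then show thesis
    using measQ' by (intro that) auto
qed

section \<open>Contradiction with extremality\<close>

lemma finite_scaling_below:
  fixes f w :: "'a \<Rightarrow> real"
  assumes "finite F" "\<And>p. p \<in> F \<Longrightarrow> 0 < w p"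
  obtains \<epsilon> where "0 < \<epsilon>" "\<And>p. p \<in> F \<Longrightarrow> \<epsilon> * \<bar>f p\<bar> \<le> w p"
proof
  \<comment> \<open>The inserted 1 covers an empty \<open>F\<close>, and the added 1 in the
    denominator avoids division by zero.\<close>
  let ?\<epsilon> = "Min (insert 1 ((\<lambda>p. w p / (\<bar>f p\<bar> + 1)) ` F))"
  show "0 < ?\<epsilon>"
    using assms by (auto intro!: divide_pos_pos add_nonneg_pos)
  show "?\<epsilon> * \<bar>f p\<bar> \<le> w p" if "p \<in> F" for p
  proof -
    have "?\<epsilon> \<le> w p / (\<bar>f p\<bar> + 1)"
      using assms(1) that by (intro Min_le) auto
    then have "?\<epsilon> * (\<bar>f p\<bar> + 1) \<le> w p"
      by (simp add: pos_le_divide_eq add_nonneg_pos)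
    then show ?thesis
      using \<open>0 < ?\<epsilon>\<close> by (simp add: distrib_left)
  qed
qed

theorem proposition7p4:
  fixes \<mu> \<nu> :: "real measure" and X Y :: "real set" and Q :: "(real \<times> real) measure"
  assumes "prob_on_halfline \<mu>" and "prob_on_halfline \<nu>"
    and "countable X" and "X \<subseteq> {0..}" and "AE x in \<mu>. x \<in> X"
    and "countable Y" and "Y \<subseteq> {0..}" and "AE y in \<nu>. y \<in> Y"
    and "(\<integral>x. x \<partial>\<mu>) = 1" and "(\<integral>y. y \<partial>\<nu>) = 1"
    and "convex_order \<mu> \<nu>"
    and "extremal_coupling \<mu> \<nu> Q"
  shows "\<not> contains_2mesh_cycle X Y (coupling_support X Y Q)"
proof
  assume "contains_2mesh_cycle X Y (coupling_support X Y Q)"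
  then obtain U V \<theta> where fin: "finite U" "finite V"
    and supp: "{p. \<theta> p \<noteq> 0} \<subseteq> coupling_support X Y Q \<inter> U \<times> V"
    and cols: "\<forall>v. (\<Sum>u\<in>U. \<theta> (u, v)) = 0"
    and rows: "\<forall>u. (\<Sum>v\<in>V. \<theta> (u, v)) = 0" "\<forall>u. (\<Sum>v\<in>V. v * \<theta> (u, v)) = 0"
    and nz: "\<exists>p. \<theta> p \<noteq> (0::real)"
    by (rule cycle_signed_measure)
  have Q: "Q \<in> martingale_couplings \<mu> \<nu>"
    using assms(12) by (simp add: extremal_coupling_def)
  have pos: "0 < measure Q {p}" if "\<theta> p \<noteq> 0" for p
    using supp that by (auto simp: coupling_support_def)
  have "finite {p. \<theta> p \<noteq> 0}"
    by (rule finite_subset[of _ "U \<times> V"]) (use supp fin in auto)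
  then obtain \<epsilon> where \<epsilon>: "0 < \<epsilon>" "\<And>p. \<theta> p \<noteq> 0 \<Longrightarrow> \<epsilon> * \<bar>\<theta> p\<bar> \<le> measure Q {p}"
    using finite_scaling_below[of "{p. \<theta> p \<noteq> 0}" "\<lambda>p. measure Q {p}" \<theta>] pos by auto
  \<comment> \<open>Both signs of the perturbation are treated at once, with \<open>c\<close> equal
    to \<open>\<epsilon>\<close> or \<open>- \<epsilon>\<close>.\<close>
  have ex: "\<exists>Q'\<in>martingale_couplings \<mu> \<nu>. \<forall>A\<in>sets Q. measure Q' A =
      measure Q A + c * (\<Sum>p\<in>U \<times> V. \<theta> p * indicator A p)" if c: "\<bar>c\<bar> = \<epsilon>" for c
  proof -
    have supp': "u \<in> U \<and> v \<in> V" if "c * \<theta> (u, v) \<noteq> 0" for u v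
      using supp that by auto
    have bound: "\<bar>c * \<theta> p\<bar> \<le> measure Q {p}" for p
      using \<epsilon>(2)[of p] c by (cases "\<theta> p = 0") (auto simp: abs_mult)
    have cols': "(\<Sum>u\<in>U. c * \<theta> (u, v)) = 0" for v
      using cols by (simp flip: sum_distrib_left)
    have rows': "(\<Sum>v\<in>V. c * \<theta> (u, v)) = 0" for u
      using rows(1) by (simp flip: sum_distrib_left)
    have "(\<Sum>v\<in>V. v * (c * \<theta> (u, v))) = c * (\<Sum>v\<in>V. v * \<theta> (u, v))" for u
      by (simp add: sum_distrib_left mult.left_commute)
    then have means: "(\<Sum>v\<in>V. v * (c * \<theta> (u, v))) = 0" for u
      using rows(2) by simp
    obtain Q' where "Q' \<in> martingale_couplings \<mu> \<nu>" "\<forall>A\<in>sets Q.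
        measure Q' A = measure Q A + (\<Sum>p\<in>U \<times> V. c * \<theta> p * indicator A p)"
      by (rule martingale_couplings_perturbation[OF Q fin supp' bound cols' rows' means])
    then show ?thesis
      by (auto simp: mult.assoc sum_distrib_left)
  qed
  obtain Q1 where Q1: "Q1 \<in> martingale_couplings \<mu> \<nu>"
    "\<And>A. A \<in> sets Q \<Longrightarrow> measure Q1 A = measure Q A + \<epsilon> * (\<Sum>p\<in>U \<times> V. \<theta> p * indicator A p)"
    using ex[of \<epsilon>] \<epsilon>(1) by auto
  obtain Q2 where Q2: "Q2 \<in> martingale_couplings \<mu> \<nu>"
    "\<And>A. A \<in> sets Q \<Longrightarrow> measure Q2 A = measure Q A + - \<epsilon> * (\<Sum>p\<in>U \<times> V. \<theta> p * indicator A p)"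
    using ex[of "- \<epsilon>"] \<epsilon>(1) by auto
  have "\<forall>A\<in>sets Q. measure Q A = 1/2 * measure Q1 A + (1 - 1/2) * measure Q2 A"
    using Q1(2) Q2(2) by (auto simp: field_simps)
  moreover have "(0::real) < 1/2" "1/2 < (1::real)"
    by simp_all
  ultimately have "Q = Q1"
    using assms(12) Q1(1) Q2(1) unfolding extremal_coupling_def by blast
  obtain p where p: "\<theta> p \<noteq> 0"
    using nz by blast
  then have "{p} \<in> sets Q" "p \<in> U \<times> V"
    using pos[OF p] measure_notin_sets[of "{p}" Q] supp by auto
  \<comment> \<open>Tested on an atom \<open>p\<close> of \<open>\<theta>\<close>, the measures
    \<open>Q1\<close> and \<open>Q\<close> differ by \<open>\<epsilon> * \<theta> p\<close>, which
    is nonzero.\<close>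
  then have "(\<Sum>a\<in>U \<times> V. \<theta> a * indicator {p} a) = \<theta> p"
    using fin by (simp add: indicator_def if_distrib sum.delta cong: if_cong)
  then show False
    using Q1(2)[OF \<open>{p} \<in> sets Q\<close>] \<open>Q = Q1\<close> \<epsilon>(1) p by simp
qed

end
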